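(* Let $G$ and $G'$ be finite abelian groups. If $\zeta_G(s)=\zeta_{G'}(s)$, then $G\cong G'$. That is, within finite abelian groups, the zeta function $\zeta_G(s)$ determines the isomorphism class of $G$.
   Context: For a finite group $G$ and $m\ge 1$, let $a_m(G)$ be the number of subgroups of $G$ of order $m$. The zeta function of $G$ is $\zeta_G(s)=\sum_{m\ge1} a_m(G)\,m^{-s}=\sum_{H\le G}|H|^{-s}$, $s\in\mathbb C$. Equality of zeta functions means equality as functions of $s$. *)

theory Defs
  imports "HOL-Analysis.Analysis" "HOL-Algebra.Algebra"
begin

definition num_subgroups :: "('a, 'b) monoid_scheme \<Rightarrow> nat \<Rightarrow> nat" where
  "num_subgroups G m = card {H. subgroup H G \<and> card H = m}"

(* For finite G only finitely many terms are nonzero (group_zeta_summable), and the value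
   is the sum of |H|^(-s) over all subgroups H (group_zeta_eq_sum_subgroups). *)
definition group_zeta :: "('a, 'b) monoid_scheme \<Rightarrow> complex \<Rightarrow> complex" where
  "group_zeta G s = (\<Sum>\<^sub>\<infinity>m\<in>{1..}. of_nat (num_subgroups G m) * of_nat m powr (- s))"

lemma finite_subgroups:
  assumes "finite (carrier G)"
  shows "finite {H. subgroup H G}"
  by (rule finite_subset[of _ "Pow (carrier G)"]) (use assms in \<open>auto dest: subgroup.subset\<close>)

lemma card_subgroup_bounds:
  assumes "finite (carrier G)" "subgroup H G"
  shows "card H \<in> {1..order G}"
proof -
  have "H \<subseteq> carrier G" and "\<one>\<^bsub>G\<^esub> \<in> H"
    using assms(2) by (auto simp: subgroup.subset subgroup.one_closed)
  then show ?thesis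
    using assms(1) finite_subset[of H "carrier G"] card_gt_0_iff[of H]
    by (auto simp: order_def Suc_le_eq intro: card_mono)
qed

lemma num_subgroups_eq_0:
  assumes "finite (carrier G)" "m \<notin> {1..order G}"
  shows "num_subgroups G m = 0"
proof -
  have "{H. subgroup H G \<and> card H = m} = {}"
    using card_subgroup_bounds[OF assms(1)] assms(2) by blast
  then show ?thesis
    by (simp only: num_subgroups_def card.empty)
qed

lemma group_zeta_summable:
  assumes "finite (carrier G)"
  shows "(\<lambda>m. of_nat (num_subgroups G m) * of_nat m powr (- s) :: complex) summable_on {1..}"
proof -
  have "(\<lambda>m. of_nat (num_subgroups G m) * of_nat m powr (- s) :: complex) summable_on {1..order G}"
    by simp
  then show ?thesis
    by (subst summable_on_cong_neutral[where T = "{1..order G}"])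
       (auto simp: num_subgroups_eq_0[OF assms])
qed

lemma group_zeta_eq_sum_subgroups:
  assumes "finite (carrier G)"
  shows "group_zeta G s = (\<Sum>H | subgroup H G. of_nat (card H) powr (- s))"
proof -
  have "group_zeta G s = (\<Sum>m=1..order G. of_nat (num_subgroups G m) * of_nat m powr (- s))"
    unfolding group_zeta_def
    by (subst infsum_cong_neutral[where T = "{1..order G}"])
       (auto simp: num_subgroups_eq_0[OF assms])
  also have "\<dots> = (\<Sum>m=1..order G. \<Sum>H\<in>{H \<in> {H. subgroup H G}. card H = m}. of_nat (card H) powr (- s))"
    by (intro sum.cong refl) (simp add: num_subgroups_def)
  also have "\<dots> = (\<Sum>H | subgroup H G. of_nat (card H) powr (- s))"
    by (rule sum.group) (use finite_subgroups[OF assms] card_subgroup_bounds[OF assms] in auto)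
  finally show ?thesis .
qed

end

theory Submission
  imports Defs
begin

text \<open>
  Evaluating the zeta function at \<open>s = -k\<close> for all \<open>k\<close> recovers the number of subgroups of each
  order. A finite abelian group is determined by the numbers of elements of each order: split off
  a cyclic subgroup of maximal order and induct. So it remains to recover, by induction on \<open>n\<close>, the
  number of elements of order \<open>n\<close>. A subgroup of order \<open>n\<close> is either cyclic or has exponent \<open>d < n\<close>.
  In the latter case it lies in the \<open>d\<close>-torsion subgroup, which is already determined up to
  isomorphism by the induction hypothesis. Hence the number of cyclic subgroups of order \<open>n\<close> is
  known, and with it the number of elements of order \<open>n\<close>.
\<close>

subsection \<open>Recovering the subgroup counts\<close>

text \<open>Invertibility of a Vandermonde system, in Lagrange form: by linearity the hypothesis
  extends from monomials to all polynomials, and the polynomial whose roots are the nodes other than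
  \<open>z a\<close> isolates \<open>c a\<close>.\<close>

lemma sum_powers_eq_0_imp_coeff_eq_0:
  fixes c :: "'a \<Rightarrow> complex" and z :: "'a \<Rightarrow> complex"
  assumes "finite A" "inj_on z A" and sum0: "\<And>k::nat. (\<Sum>a\<in>A. c a * z a ^ k) = 0" and "a \<in> A"
  shows "c a = 0"
proof -
  have poly0: "(\<Sum>a\<in>A. c a * poly p (z a)) = 0" for p
  proof -
    have "(\<Sum>a\<in>A. c a * poly p (z a)) = (\<Sum>a\<in>A. \<Sum>i\<le>Polynomial.degree p. Polynomial.coeff p i * (c a * z a ^ i))"
      by (simp add: poly_altdef sum_distrib_left mult_ac)
    also have "\<dots> = (\<Sum>i\<le>Polynomial.degree p. Polynomial.coeff p i * (\<Sum>a\<in>A. c a * z a ^ i))"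
      by (subst sum.swap) (simp add: sum_distrib_left)
    finally show ?thesis by (simp add: sum0)
  qed
  define p where "p = (\<Prod>b\<in>A - {a}. [:- z b, 1:])"
  have "(\<Sum>b\<in>A. c b * poly p (z b)) = (\<Sum>b\<in>{a}. c b * poly p (z b))"
    using \<open>finite A\<close> \<open>a \<in> A\<close>
    by (intro sum.mono_neutral_right) (auto simp: p_def poly_prod intro!: prod_zero)
  then have "c a * poly p (z a) = 0"
    by (simp add: poly0)
  moreover have "poly p (z a) \<noteq> 0"
    using assms by (auto simp: p_def poly_prod inj_on_def)
  ultimately show ?thesis by simp
qed

text \<open>At negative integers the zeta function becomes a power sum. The free bound
  \<open>N\<close> lets two groups be summed over one common range.\<close>

lemma group_zeta_neg_of_nat:
  assumes "finite (carrier G)" "order G \<le> N"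
  shows "group_zeta G (- of_nat k) = (\<Sum>m=1..N. of_nat (num_subgroups G m) * of_nat m ^ k)"
proof -
  have "group_zeta G (- of_nat k) =
      (\<Sum>m=1..N. of_nat (num_subgroups G m) * of_nat m powr (of_nat k))"
    unfolding group_zeta_def using assms(2)
    by (subst infsum_cong_neutral[where T = "{1..N}"])
       (auto simp: num_subgroups_eq_0[OF assms(1)])
  also have "\<dots> = (\<Sum>m=1..N. of_nat (num_subgroups G m) * of_nat m ^ k)"
    by (intro sum.cong refl) (auto simp: powr_nat')
  finally show ?thesis .
qed

text \<open>The differences of the counts have vanishing power sums over the distinct nodes
  \<open>1..N\<close>, so they vanish; outside this range both counts are 0.\<close>

lemma group_zeta_determines_num_subgroups:
  assumes "finite (carrier G)" "finite (carrier G')"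
    and "\<And>s. group_zeta G s = group_zeta G' s"
  shows "num_subgroups G m = num_subgroups G' m"
proof -
  define N where "N = max (order G) (order G')"
  have "(\<Sum>m=1..N. (of_nat (num_subgroups G m) - of_nat (num_subgroups G' m)) * of_nat m ^ k) =
      (0::complex)" for k
    using assms(3)[of "- of_nat k"] group_zeta_neg_of_nat[OF assms(1), of N k]
      group_zeta_neg_of_nat[OF assms(2), of N k]
    by (simp add: N_def algebra_simps sum_subtractf)
  then have "of_nat (num_subgroups G m) - of_nat (num_subgroups G' m) = (0::complex)" if "m \<in> {1..N}"
    using that
    by (intro sum_powers_eq_0_imp_coeff_eq_0[of "{1..N}" of_nat
          "\<lambda>m. of_nat (num_subgroups G m) - of_nat (num_subgroups G' m)"])
       (simp_all add: inj_on_def)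
  moreover have "num_subgroups G m = num_subgroups G' m" if "m \<notin> {1..N}"
    using that num_subgroups_eq_0[OF assms(1), of m] num_subgroups_eq_0[OF assms(2), of m]
    by (auto simp: N_def)
  ultimately show ?thesis by force
qed

subsection \<open>Splitting off a cyclic factor of maximal order\<close>

lemma (in group) ord_subgroup_consistent:
  assumes "subgroup H G"
  shows "group.ord (G\<lparr>carrier := H\<rparr>) x = ord x"
  using group.ord_def[OF subgroup.subgroup_is_group[OF assms is_group], of x]
  by (simp add: ord_def flip: nat_pow_consistent)

text \<open>Raising \<open>a \<otimes> b\<close> to the power
  \<open>ord (a \<otimes> b) * ord b\<close> kills the factor \<open>b\<close>, so
  \<open>ord a\<close> divides that exponent, and coprimality removes \<open>ord b\<close> from
  it.\<close>

lemma (in comm_group) ord_mult_coprime: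
  assumes "x \<in> carrier G" "y \<in> carrier G" "coprime (ord x) (ord y)"
  shows "ord (x \<otimes> y) = ord x * ord y"
proof (rule dvd_antisym)
  show "ord (x \<otimes> y) dvd ord x * ord y"
    using assms by (simp add: abelian_ord_mul_divides)
  have *: "ord a dvd ord (a \<otimes> b)"
    if ab: "a \<in> carrier G" "b \<in> carrier G" "coprime (ord a) (ord b)" for a b
  proof -
    let ?n = "ord (a \<otimes> b) * ord b"
    have "\<one> = (a \<otimes> b) [^] ?n"
      using ab by (simp add: nat_pow_pow[symmetric])
    also have "\<dots> = a [^] ?n \<otimes> b [^] ?n"
      using ab by (simp add: nat_pow_distrib)
    also have "b [^] ?n = \<one>"
      using ab by (simp add: pow_eq_id)
    finally have "a [^] ?n = \<one>"
      using ab by simp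
    then have "ord a dvd ?n"
      using ab pow_eq_id by simp
    then show ?thesis
      using ab(3) coprime_dvd_mult_left_iff by blast
  qed
  show "ord x * ord y dvd ord (x \<otimes> y)"
    using *[of x y] *[of y x] assms by (simp add: divides_mult m_comm coprime_commute)
qed

text \<open>Any element of maximal order works. If some \<open>ord y\<close> had a higher power of a
  prime \<open>p\<close> than \<open>ord x\<close>, then the \<open>p\<close>-free part of
  \<open>x\<close> times the \<open>p\<close>-part of \<open>y\<close> would have larger order than
  \<open>x\<close>.\<close>

lemma (in comm_group) exists_ord_multiple_of_all_ords:
  assumes fin: "finite (carrier G)"
  obtains x where "x \<in> carrier G" "\<And>y. y \<in> carrier G \<Longrightarrow> ord y dvd ord x"
proof -
  have "finite (ord ` carrier G)" "ord ` carrier G \<noteq> {}"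
    using fin one_closed by auto
  from Max_in[OF this] obtain x where x: "x \<in> carrier G" "ord x = Max (ord ` carrier G)"
    by (metis imageE)
  then have max: "ord y \<le> ord x" if "y \<in> carrier G" for y
    using fin that by simp
  have "ord y dvd ord x" if y: "y \<in> carrier G" for y
  proof (rule ccontr)
    assume ndvd: "\<not> ord y dvd ord x"
    have pos: "ord x > 0" "ord y > 0"
      using ord_ge_1[OF fin] x(1) y by force+
    have "\<not> (\<forall>p. Factorial_Ring.prime p \<longrightarrow> multiplicity p (ord y) \<le> multiplicity p (ord x))"
      using ndvd multiplicity_le_imp_dvd[of "ord y" "ord x"] pos by blast
    then obtain p where p: "Factorial_Ring.prime p" "multiplicity p (ord x) < multiplicity p (ord y)"
      unfolding not_all not_imp not_le by blast
    define a b where "a = multiplicity p (ord x)" and "b = multiplicity p (ord y)"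
    have p1: "\<not> is_unit p" using p(1) not_prime_unit by blast
    obtain m where m: "ord x = p ^ a * m" "\<not> p dvd m"
      using multiplicity_decompose'[where x = "ord x" and p = p] p1 pos unfolding a_def by blast
    obtain n where n: "ord y = p ^ b * n"
      using multiplicity_decompose'[where x = "ord y" and p = p] p1 pos unfolding b_def by blast
    have p0: "p > 0" using p(1) prime_gt_0_nat by blast
    have n0: "n \<noteq> 0" using n pos by auto
    have ordx: "ord (x [^] (p ^ a)) = m"
      using m x(1) p0 by (subst ord_pow) auto
    have ordy: "ord (y [^] n) = p ^ b"
      using n y n0 by (subst ord_pow) auto
    have "coprime m (p ^ b)"
      using prime_imp_coprime[OF p(1) m(2)] by (simp add: coprime_commute)
    then have "ord (x [^] (p ^ a) \<otimes> y [^] n) = m * p ^ b"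
      using x(1) y by (subst ord_mult_coprime) (auto simp: ordx ordy)
    then have "m * p ^ b \<le> m * p ^ a"
      using max[of "x [^] (p ^ a) \<otimes> y [^] n"] x(1) y m(1) by (simp add: mult.commute)
    moreover have "p ^ a < p ^ b"
      using p prime_gt_1_nat by (simp add: a_def b_def)
    moreover have "m > 0" using pos m by (auto intro: gr0I)
    ultimately show False by simp
  qed
  with x(1) show ?thesis using that by blast
qed

text \<open>Bezout: \<open>x\<close> is a product of integer powers of \<open>x [^] a\<close> and
  \<open>x [^] b\<close>.\<close>

lemma (in group) mem_subgroup_if_coprime_powers:
  assumes M: "subgroup M G" and x: "x \<in> carrier G"
    and "x [^] (a::nat) \<in> M" "x [^] (b::nat) \<in> M" "coprime a b"
  shows "x \<in> M"
proof -
  have "coprime (int a) (int b)" using assms(5) by simp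
  then obtain u v where uv: "u * int a + v * int b = 1"
    by (metis bezout_int coprime_iff_gcd_eq_1)
  have "x = x [^] (int a * u + int b * v)"
    using x uv by (simp add: mult.commute)
  also have "\<dots> = (x [^] a) [^] u \<otimes> (x [^] b) [^] v"
    using x by (simp add: int_pow_mult int_pow_pow[symmetric] int_pow_int)
  also have "\<dots> \<in> M"
    using assms by (simp add: subgroup.m_closed subgroup_int_pow_closed)
  finally show ?thesis .
qed

lemma (in comm_group) cyclic_subgroup_complement:
  assumes fin: "finite (carrier G)" and g: "g \<in> carrier G"
    and exp: "\<And>y. y \<in> carrier G \<Longrightarrow> ord y dvd ord g"
  obtains K where "subgroup K G" "generate G {g} \<inter> K = {\<one>}"
    "generate G {g} <#> K = carrier G"
proof -
  define A where "A = generate G {g}"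
  have A: "subgroup A G"
    using g by (simp add: A_def generate_is_subgroup)
  have A_eq: "A = {g [^] k | k. k \<in> (UNIV::nat set)}"
    using generate_pow_on_finite_carrier[OF fin g] by (simp add: A_def)
  \<comment> \<open>If \<open>A <#> K\<close> is proper, some \<open>x1\<close> outside it has \<open>x1 [^] p \<in> K\<close> for a prime \<open>p\<close>, and
    adjoining \<open>x1\<close> to \<open>K\<close> contradicts maximality.\<close>
  define \<K> where "\<K> = {K. subgroup K G \<and> A \<inter> K = {\<one>}}"
  have "finite \<K>"
    using finite_subgroups[OF fin] by (auto simp: \<K>_def)
  moreover have "{\<one>} \<in> \<K>"
    using subgroup.one_closed[OF A] by (auto simp: \<K>_def triv_subgroup)
  ultimately obtain K where K: "subgroup K G" "A \<inter> K = {\<one>}"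
    and max: "\<And>L. L \<in> \<K> \<Longrightarrow> K \<subseteq> L \<Longrightarrow> K = L"
    using finite_has_maximal[of \<K>] by (auto simp: \<K>_def)
  define M where "M = A <#> K"
  have M: "subgroup M G"
    unfolding M_def by (rule mult_subgroups[OF A K(1)])
  have in_M: "a \<otimes> k \<in> M" if "a \<in> A" "k \<in> K" for a k
    using that by (auto simp: M_def set_mult_def)
  have AM: "A \<subseteq> M" and KM: "K \<subseteq> M"
    using in_M[of _ \<one>] in_M[of \<one>] subgroup.one_closed[OF A] subgroup.one_closed[OF K(1)]
      subgroup.mem_carrier[OF A] subgroup.mem_carrier[OF K(1)] by fastforce+
  have "M = carrier G"
  proof (rule ccontr)
    assume "M \<noteq> carrier G"
    then obtain x where x: "x \<in> carrier G" "x \<notin> M"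
      using subgroup.subset[OF M] by auto
    \<comment> \<open>\<open>k\<close> is the order of \<open>x\<close> modulo \<open>M\<close>. For
      a prime \<open>p\<close> dividing it, the power \<open>x [^] (k div p)\<close> lies outside
      \<open>M\<close> while its \<open>p\<close>-th power lies in \<open>M\<close>.\<close>
    define k where "k = (LEAST n::nat. n > 0 \<and> x [^] n \<in> M)"
    have "ord x > 0 \<and> x [^] ord x \<in> M"
      using x ord_ge_1[OF fin x(1)] subgroup.one_closed[OF M] by simp
    then have k: "k > 0" "x [^] k \<in> M"
      using LeastI[of "\<lambda>n::nat. n > 0 \<and> x [^] n \<in> M" "ord x"] by (simp_all add: k_def)
    have k_le: "k \<le> n" if "n > 0" "x [^] n \<in> M" for n
      unfolding k_def using that by (intro Least_le) auto
    have "k \<noteq> 1" using k(2) x by auto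
    then obtain p where p: "Factorial_Ring.prime p" "p dvd k"
      using prime_factor_nat by blast
    define x0 where "x0 = x [^] (k div p)"
    have x0: "x0 \<in> carrier G" using x by (simp add: x0_def)
    have x0p: "x0 [^] p \<in> M"
      using x p k by (simp add: x0_def nat_pow_pow)
    have x0M: "x0 \<notin> M"
    proof
      assume "x0 \<in> M"
      then have "k \<le> k div p"
        using k_le[of "k div p"] p k(1)
        by (simp add: x0_def div_greater_zero_iff dvd_imp_le prime_gt_0_nat)
      then show False
        using div_less_dividend[OF prime_gt_1_nat[OF p(1)] k(1)] by simp
    qed
    have "x0 [^] p \<in> A <#> K" using x0p by (simp add: M_def)
    then obtain i :: nat and c where ic: "x0 [^] p = g [^] i \<otimes> c" "c \<in> K"
      by (auto simp: A_eq set_mult_def)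
    have c: "c \<in> carrier G" by (rule subgroup.mem_carrier[OF K(1) ic(2)])
    have x0m: "x0 [^] ord g = \<one>"
      using exp[OF x0] x0 by (simp add: pow_eq_id)
    \<comment> \<open>Otherwise \<open>x0\<close> would lie in \<open>M\<close>, since its powers
      with the coprime exponents \<open>p\<close> and \<open>ord g\<close> do; the latter power is
      trivial.\<close>
    have "p dvd ord g"
    proof (rule ccontr)
      assume "\<not> p dvd ord g"
      then have "coprime p (ord g)" using p(1) by (simp add: prime_imp_coprime)
      then show False
        using mem_subgroup_if_coprime_powers[OF M x0 x0p, of "ord g"] x0M x0m
          subgroup.one_closed[OF M] by simp
    qed
    then obtain t where t: "ord g = p * t" by blast
    then have "t > 0" using ord_ge_1[OF fin g] by (auto intro: gr0I)
    \<comment> \<open>This is \<open>x0 [^] p = g [^] i \<otimes> c\<close> raised to the power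
      \<open>t\<close>. It puts \<open>g [^] (i * t)\<close> into both \<open>A\<close> and
      \<open>K\<close>, so this power is trivial and \<open>p\<close> divides
      \<open>i\<close>.\<close>
    have "g [^] (i * t) \<otimes> c [^] t = \<one>"
      using x0m x0 c g ic(1) t by (simp add: nat_pow_pow[symmetric] nat_pow_distrib)
    moreover have ct: "c [^] t \<in> K"
      using subgroup_int_pow_closed[OF K(1) ic(2), of "int t"] by (simp add: int_pow_int)
    ultimately have "g [^] (i * t) \<in> K"
      using c g subgroup.m_inv_closed[OF K(1) ct] inv_equality by fastforce
    then have "g [^] (i * t) = \<one>"
      using K(2) A_eq by blast
    then have "p * t dvd i * t"
      using g t by (simp add: pow_eq_id)
    then obtain j where j: "i = p * j"
      using \<open>t > 0\<close> by auto
    \<comment> \<open>Dividing by the \<open>p\<close>-th root \<open>g [^] j\<close> of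
      \<open>g [^] i\<close> removes the \<open>A\<close>-component of the \<open>p\<close>-th
      power. As \<open>g [^] j\<close> lies in \<open>M\<close>, the new element stays outside
      \<open>M\<close>.\<close>
    define x1 where "x1 = x0 \<otimes> inv (g [^] j)"
    have x1: "x1 \<in> carrier G" using x0 g by (simp add: x1_def)
    have gj: "g [^] j \<in> A" by (auto simp: A_eq)
    have x1p: "x1 [^] p = c"
    proof -
      have "x1 [^] p = x0 [^] p \<otimes> inv (g [^] i)"
        using x0 g by (simp add: x1_def nat_pow_distrib nat_pow_inv[symmetric] nat_pow_pow j mult.commute)
      also have "\<dots> = c"
        using ic c g by (simp add: m_comm[of "g [^] i" c] m_assoc)
      finally show ?thesis .
    qed
    have x1M: "x1 \<notin> M"
    proof
      assume "x1 \<in> M"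
      then have "x1 \<otimes> g [^] j \<in> M"
        using gj AM subgroup.m_closed[OF M] by blast
      then show False using x0M x0 g by (simp add: x1_def m_assoc)
    qed
    define C where "C = generate G {x1}"
    have C: "subgroup C G" using x1 by (simp add: C_def generate_is_subgroup)
    have C_eq: "C = {x1 [^] k | k. k \<in> (UNIV::nat set)}"
      using generate_pow_on_finite_carrier[OF fin x1] by (simp add: C_def)
    have CK: "subgroup (C <#> K) G"
      by (rule mult_subgroups[OF C K(1)])
    have "x1 \<otimes> \<one> \<in> C <#> K"
      using subgroup.one_closed[OF K(1)]
      by (auto simp: C_def set_mult_def intro: generate.incl)
    then have "x1 \<in> C <#> K" using x1 by simp
    moreover have "K \<subseteq> C <#> K"
    proof
      fix y assume y: "y \<in> K"
      then have "\<one> \<otimes> y \<in> C <#> K"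
        using subgroup.one_closed[OF C] by (auto simp: set_mult_def)
      then show "y \<in> C <#> K" using y subgroup.mem_carrier[OF K(1)] by simp
    qed
    \<comment> \<open>\<open>C <#> K\<close> is a strictly larger subgroup than \<open>K\<close>,
      because it contains \<open>x1\<close>; by maximality it must meet \<open>A\<close>
      nontrivially.\<close>
    ultimately have "C <#> K \<notin> \<K>"
      using max[of "C <#> K"] x1M KM by auto
    then obtain z where z: "z \<in> A" "z \<in> C <#> K" "z \<noteq> \<one>"
      using CK subgroup.one_closed[OF A] subgroup.one_closed[OF CK] by (auto simp: \<K>_def)
    then obtain r :: nat and d where rd: "z = x1 [^] r \<otimes> d" "d \<in> K"
      by (auto simp: C_eq set_mult_def)
    have d: "d \<in> carrier G" by (rule subgroup.mem_carrier[OF K(1) rd(2)])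
    have zc: "z \<in> carrier G" by (rule subgroup.mem_carrier[OF A z(1)])
    \<comment> \<open>If \<open>p\<close> divides \<open>r\<close>, then \<open>x1 [^] r\<close> is
      a power of \<open>c\<close>, so \<open>z\<close> lies in \<open>A \<inter> K\<close>.
      Otherwise \<open>x1\<close> has powers in \<open>M\<close> with coprime exponents
      \<open>p\<close> and \<open>r\<close>, which forces \<open>x1\<close> into
      \<open>M\<close>.\<close>
    show False
    proof (cases "p dvd r")
      case True
      then obtain s where "r = p * s" by blast
      then have "x1 [^] r = c [^] int s"
        using x1 by (simp add: nat_pow_pow[symmetric] x1p int_pow_int)
      then have "x1 [^] r \<in> K"
        using subgroup_int_pow_closed[OF K(1) ic(2)] by simp
      then have "z \<in> K"
        using rd subgroup.m_closed[OF K(1)] by simp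
      then show False using K(2) z by blast
    next
      case False
      then have "coprime p r" using p(1) by (simp add: prime_imp_coprime)
      moreover have "x1 [^] r = z \<otimes> inv d"
        using rd x1 d by (simp add: m_assoc)
      then have "x1 [^] r \<in> M"
        using in_M z(1) subgroup.m_inv_closed[OF K(1) rd(2)] by simp
      moreover have "x1 [^] p \<in> M" using x1p ic(2) KM by auto
      ultimately show False
        using mem_subgroup_if_coprime_powers[OF M x1] x1M by blast
    qed
  qed
  with K that show ?thesis by (auto simp: A_def M_def)
qed

section \<open>Torsion counts as a complete invariant of finite abelian groups\<close>

definition torsion :: "('a, 'b) monoid_scheme \<Rightarrow> nat \<Rightarrow> 'a set" where
  "torsion G n = {x \<in> carrier G. x [^]\<^bsub>G\<^esub> n = \<one>\<^bsub>G\<^esub>}"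

lemma (in comm_group) torsion_subgroup: "subgroup (torsion G n) G"
  by (intro subgroupI) (auto simp: torsion_def nat_pow_distrib nat_pow_inv)

lemma card_torsion_iso:
  assumes "group G" "group H" "G \<cong> H"
  shows "card (torsion G n) = card (torsion H n)"
proof -
  interpret G: group G by fact
  interpret H: group H by fact
  obtain f where f: "f \<in> iso G H" using assms(3) by (auto simp: is_iso_def)
  then have hom: "f \<in> hom G H" and bij: "bij_betw f (carrier G) (carrier H)"
    by (auto simp: iso_def)
  have "f x [^]\<^bsub>H\<^esub> n = \<one>\<^bsub>H\<^esub> \<longleftrightarrow> x [^]\<^bsub>G\<^esub> n = \<one>\<^bsub>G\<^esub>" if "x \<in> carrier G" for x
  proof -
    have "f x [^]\<^bsub>H\<^esub> n = f (x [^]\<^bsub>G\<^esub> n)"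
      using hom_nat_pow[OF hom that assms(1,2)] by simp
    moreover have "f \<one>\<^bsub>G\<^esub> = \<one>\<^bsub>H\<^esub>"
      using hom assms(1,2) hom_one by blast
    ultimately show ?thesis
      using bij that by (metis G.nat_pow_closed G.one_closed bij_betw_def inj_on_eq_iff)
  qed
  then have "bij_betw f (torsion G n) (torsion H n)"
    unfolding torsion_def by (intro bij_betw_Collect[OF bij])
  then show ?thesis by (rule bij_betw_same_card)
qed

lemma torsion_DirProd: "torsion (G \<times>\<times> H) n = torsion G n \<times> torsion H n"
proof -
  have "(x, y) [^]\<^bsub>G \<times>\<times> H\<^esub> n = (x [^]\<^bsub>G\<^esub> n, y [^]\<^bsub>H\<^esub> n)" for x y
    by (induction n) (simp_all add: DirProd_def)
  then show ?thesis by (auto simp: torsion_def DirProd_def)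
qed

lemma cyclic_subgroups_iso:
  assumes "group G" "group G'" and g: "g \<in> carrier G" "g' \<in> carrier G'"
    and ord: "group.ord G g = group.ord G' g'"
  shows "G\<lparr>carrier := generate G {g}\<rparr> \<cong> G'\<lparr>carrier := generate G' {g'}\<rparr>"
proof -
  interpret G: group G by fact
  interpret G': group G' by fact
  \<comment> \<open>\<open>SOME\<close> picks a discrete logarithm to base \<open>g\<close>. The
    choice does not matter: two logarithms differ by a multiple of \<open>ord g\<close>, which is
    also the order of \<open>g'\<close>.\<close>
  define f where "f x = g' [^]\<^bsub>G'\<^esub> (SOME i::int. x = g [^]\<^bsub>G\<^esub> i)" for x
  have f: "f (g [^]\<^bsub>G\<^esub> i) = g' [^]\<^bsub>G'\<^esub> i" for i :: int
  proof -
    have "g [^]\<^bsub>G\<^esub> i = g [^]\<^bsub>G\<^esub> (SOME j::int. g [^]\<^bsub>G\<^esub> i = g [^]\<^bsub>G\<^esub> j)"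
      by (rule someI) (rule refl)
    then show ?thesis
      using g by (simp add: f_def G.int_pow_eq G'.int_pow_eq ord dvd_diff_commute)
  qed
  have gen: "generate G {g} = range (\<lambda>i::int. g [^]\<^bsub>G\<^esub> i)"
    "generate G' {g'} = range (\<lambda>i::int. g' [^]\<^bsub>G'\<^esub> i)"
    using G.generate_pow[OF g(1)] G'.generate_pow[OF g(2)] by auto
  have "f \<in> iso (G\<lparr>carrier := generate G {g}\<rparr>) (G'\<lparr>carrier := generate G' {g'}\<rparr>)"
  proof (rule isoI)
    show "f \<in> hom (G\<lparr>carrier := generate G {g}\<rparr>) (G'\<lparr>carrier := generate G' {g'}\<rparr>)"
      using g by (auto simp: hom_def gen f G.int_pow_mult[symmetric] G'.int_pow_mult[symmetric])
    have "inj_on f (generate G {g})"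
      using g by (auto simp: inj_on_def gen f G.int_pow_eq G'.int_pow_eq ord)
    moreover have "f ` generate G {g} = generate G' {g'}"
      by (auto simp: gen f image_image)
    ultimately show "bij_betw f (carrier (G\<lparr>carrier := generate G {g}\<rparr>))
        (carrier (G'\<lparr>carrier := generate G' {g'}\<rparr>))"
      by (simp add: bij_betw_def)
  qed
  then show ?thesis by (rule is_isoI)
qed

text \<open>Turns the internal decomposition into an external direct product, over which torsion
  counts are multiplicative.\<close>

lemma (in comm_group) cyclic_direct_factor:
  assumes fin: "finite (carrier G)"
  obtains g K where "g \<in> carrier G" "\<And>y. y \<in> carrier G \<Longrightarrow> ord y dvd ord g" "subgroup K G"
    "generate G {g} \<inter> K = {\<one>}"
    "G\<lparr>carrier := generate G {g}\<rparr> \<times>\<times> G\<lparr>carrier := K\<rparr> \<cong> G"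
proof -
  obtain g where g: "g \<in> carrier G" "\<And>y. y \<in> carrier G \<Longrightarrow> ord y dvd ord g"
    using exists_ord_multiple_of_all_ords[OF fin] by blast
  obtain K where K: "subgroup K G" "generate G {g} \<inter> K = {\<one>}"
    "generate G {g} <#> K = carrier G"
    using cyclic_subgroup_complement[OF fin g] by blast
  have A: "subgroup (generate G {g}) G" using g(1) by (simp add: generate_is_subgroup)
  interpret group_disjoint_sum G "generate G {g}" K
    using A K(1) by (simp add: group_disjoint_sum_def)
  \<comment> \<open>Reconciles two encodings of a subgroup as a group: \<open>iso_group_mul\<close>
    speaks of \<open>subgroup_generated\<close>, the rest of the proof of carrier updates.\<close>
  have eq: "subgroup_generated G H = G\<lparr>carrier := H\<rparr>" if "subgroup H G" for H
    using that by (simp add: subgroup_generated_def subgroup.subset inf.absorb2 generateI[symmetric])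
  have "G\<lparr>carrier := generate G {g}\<rparr> \<times>\<times> G\<lparr>carrier := K\<rparr> \<cong> G"
    using iso_group_mul[OF comm_group_axioms] K A by (auto simp: is_iso_def eq)
  with g K that show ?thesis by blast
qed

text \<open>Lets the multiples of the exponent be read off from the torsion counts.\<close>

lemma (in group) order_dvd_iff_torsion:
  assumes "finite (carrier G)"
  shows "(\<forall>x\<in>carrier G. ord x dvd n) \<longleftrightarrow> card (torsion G n) = card (carrier G)"
proof -
  have sub: "torsion G n \<subseteq> carrier G" by (auto simp: torsion_def)
  have "(\<forall>x\<in>carrier G. ord x dvd n) \<longleftrightarrow> torsion G n = carrier G"
    unfolding torsion_def using pow_eq_id by blast
  also have "\<dots> \<longleftrightarrow> card (torsion G n) = card (carrier G)"
    using card_subset_eq[OF assms sub] by auto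
  finally show ?thesis .
qed

lemma comm_group_subgroup:
  assumes "comm_group G" "subgroup H G"
  shows "comm_group (G\<lparr>carrier := H\<rparr>)"
proof -
  interpret comm_group G by fact
  interpret H: group "G\<lparr>carrier := H\<rparr>"
    by (rule subgroup.subgroup_is_group[OF assms(2) is_group])
  show ?thesis
    using subgroup.mem_carrier[OF assms(2)] by (intro H.group_comm_groupI) (simp add: m_comm)
qed

text \<open>The counts determine the exponent, so both groups split off cyclic factors of the same
  order. Dividing the counts by those of the cyclic factor leaves equal counts for the complements,
  to which induction on the group order applies.\<close>

lemma iso_if_card_torsion_eq:
  fixes G :: "('a, 'm) monoid_scheme" and G' :: "('b, 'n) monoid_scheme"
  assumes "comm_group G" "finite (carrier G)" "comm_group G'" "finite (carrier G')"
    and "\<And>n. n > 0 \<Longrightarrow> card (torsion G n) = card (torsion G' n)"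
  shows "G \<cong> G'"
  using assms
proof (induction "card (carrier G)" arbitrary: G G' rule: less_induct)
  case less
  interpret G: comm_group G by fact
  interpret G': comm_group G' by fact
  obtain g K where g: "g \<in> carrier G" "\<And>y. y \<in> carrier G \<Longrightarrow> G.ord y dvd G.ord g"
    and K: "subgroup K G" "generate G {g} \<inter> K = {\<one>\<^bsub>G\<^esub>}"
    and iso: "G\<lparr>carrier := generate G {g}\<rparr> \<times>\<times> G\<lparr>carrier := K\<rparr> \<cong> G"
    using G.cyclic_direct_factor[OF less.prems(2)] by metis
  obtain g' K' where g': "g' \<in> carrier G'" "\<And>y. y \<in> carrier G' \<Longrightarrow> G'.ord y dvd G'.ord g'"
    and K': "subgroup K' G'" "generate G' {g'} \<inter> K' = {\<one>\<^bsub>G'\<^esub>}"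
    and iso': "G'\<lparr>carrier := generate G' {g'}\<rparr> \<times>\<times> G'\<lparr>carrier := K'\<rparr> \<cong> G'"
    using G'.cyclic_direct_factor[OF less.prems(4)] by metis
  let ?A = "G\<lparr>carrier := generate G {g}\<rparr>" and ?A' = "G'\<lparr>carrier := generate G' {g'}\<rparr>"
  let ?K = "G\<lparr>carrier := K\<rparr>" and ?K' = "G'\<lparr>carrier := K'\<rparr>"
  have grps: "group ?A" "group ?A'" "comm_group ?K" "comm_group ?K'" "group ?K" "group ?K'"
    using subgroup.subgroup_is_group[OF G.generate_is_subgroup[of "{g}"] G.is_group] g
      subgroup.subgroup_is_group[OF G'.generate_is_subgroup[of "{g'}"] G'.is_group] g'
      comm_group_subgroup[OF less.prems(1) K(1)] comm_group_subgroup[OF less.prems(3) K'(1)]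
    by (auto simp: comm_group_def)
  have fin: "finite (carrier ?A)" "finite K" "finite K'"
    using less.prems(2,4) K(1) K'(1) G.generate_incl[of "{g}"] g
    by (auto intro: finite_subset dest: subgroup.subset)
  have pos: "G.ord g > 0" "G'.ord g' > 0"
    using G.ord_ge_1[OF less.prems(2) g(1)] G'.ord_ge_1[OF less.prems(4) g'(1)] by simp_all

  \<comment> \<open>The product of the two exponents kills both groups, so the torsion counts there
    are the group orders.\<close>
  have tors_order: "card (torsion G (G.ord g * G'.ord g')) = card (carrier G)"
    using g(2) less.prems(2) by (subst G.order_dvd_iff_torsion[symmetric]) auto
  moreover have "card (torsion G' (G.ord g * G'.ord g')) = card (carrier G')"
    using g'(2) less.prems(4) by (subst G'.order_dvd_iff_torsion[symmetric]) auto
  ultimately have card_eq: "card (carrier G) = card (carrier G')"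
    using less.prems(5)[of "G.ord g * G'.ord g'"] pos by simp
  \<comment> \<open>\<open>G'.ord g'\<close> kills all of \<open>G'\<close>; equal torsion counts
    and equal group orders then show that it kills \<open>G\<close> as well.\<close>
  have "G.ord g dvd G'.ord g'"
    using G.order_dvd_iff_torsion[of "G'.ord g'"] G'.order_dvd_iff_torsion[of "G'.ord g'"]
      less.prems(2,4) less.prems(5)[of "G'.ord g'"] pos card_eq g g' by simp
  moreover have "G'.ord g' dvd G.ord g"
    using G.order_dvd_iff_torsion[of "G.ord g"] G'.order_dvd_iff_torsion[of "G.ord g"]
      less.prems(2,4) less.prems(5)[of "G.ord g"] pos card_eq g g' by simp
  ultimately have ord_eq: "G.ord g = G'.ord g'" by (rule dvd_antisym)
  have A_iso: "?A \<cong> ?A'"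
    by (rule cyclic_subgroups_iso[OF G.is_group G'.is_group g(1) g'(1) ord_eq])

  show "G \<cong> G'"
  \<comment> \<open>In the trivial group \<open>g\<close> is the identity and splitting it off gives
    no smaller complement, so this case is separate.\<close>
  proof (cases "card (carrier G) = 1")
    case True
    then obtain a a' where "carrier G = {a}" "carrier G' = {a'}"
      using card_eq by (metis card_1_singletonE)
    then have "carrier G = {\<one>\<^bsub>G\<^esub>}" "carrier G' = {\<one>\<^bsub>G'\<^esub>}"
      using G.one_closed G'.one_closed by auto
    then have "(\<lambda>_. \<one>\<^bsub>G'\<^esub>) \<in> iso G G'"
      using G'.r_one[OF G'.one_closed] by (auto simp: iso_def hom_def bij_betw_def)
    then show ?thesis by (rule is_isoI)
  next
    case False
    have "g \<noteq> \<one>\<^bsub>G\<^esub>"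
    proof
      assume "g = \<one>\<^bsub>G\<^esub>"
      then have "y = \<one>\<^bsub>G\<^esub>" if "y \<in> carrier G" for y
        using g(2)[OF that] G.ord_eq_1[OF that] by simp
      then have "carrier G = {\<one>\<^bsub>G\<^esub>}" by auto
      then show False using False by simp
    qed
    then have "g \<notin> K"
      using K(2) generate.incl[of g "{g}" G] by blast
    then have "K \<subset> carrier G"
      using subgroup.subset[OF K(1)] g(1) by blast
    then have "card K < card (carrier G)"
      using less.prems(2) by (rule psubset_card_mono[rotated])
    have "?K \<cong> ?K'"
    proof (rule less.hyps)
      show "card (carrier ?K) < card (carrier G)" using \<open>card K < card (carrier G)\<close> by simp
      show "finite (carrier ?K)" "finite (carrier ?K')" using fin by simp_all
      fix n :: nat assume "n > 0"
      have "card (torsion ?A n) * card (torsion ?K n) = card (torsion G n)"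
        using card_torsion_iso[OF DirProd_group[OF grps(1,5)] G.is_group iso, of n]
        by (simp add: torsion_DirProd card_cartesian_product)
      moreover have "card (torsion ?A' n) * card (torsion ?K' n) = card (torsion G' n)"
        using card_torsion_iso[OF DirProd_group[OF grps(2,6)] G'.is_group iso', of n]
        by (simp add: torsion_DirProd card_cartesian_product)
      moreover have "card (torsion ?A n) = card (torsion ?A' n)"
        by (rule card_torsion_iso[OF grps(1,2) A_iso])
      ultimately have "card (torsion ?A n) * card (torsion ?K n) = card (torsion ?A n) * card (torsion ?K' n)"
        using less.prems(5)[OF \<open>n > 0\<close>] by simp
      \<comment> \<open>Needed to cancel the common cyclic factor from the two products.\<close>
      moreover have "card (torsion ?A n) \<noteq> 0"
      proof -
        have "finite (torsion ?A n)" "\<one>\<^bsub>G\<^esub> \<in> torsion ?A n"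
          using fin(1) by (auto simp: torsion_def generate.one simp flip: G.nat_pow_consistent)
        then show ?thesis by auto
      qed
      ultimately show "card (torsion ?K n) = card (torsion ?K' n)"
        by simp
    qed (use grps in auto)
    with A_iso have "?A \<times>\<times> ?K \<cong> ?A' \<times>\<times> ?K'"
      by (rule group.DirProd_iso_trans[OF grps(1)])
    then show ?thesis
      by (rule iso_trans[OF group.iso_sym[OF DirProd_group[OF grps(1,5)] iso]
            iso_trans[OF _ iso']])
  qed
qed

subsection \<open>Subgroups by order and exponent\<close>

definition num_elems_of_ord :: "('a, 'b) monoid_scheme \<Rightarrow> nat \<Rightarrow> nat" where
  "num_elems_of_ord G n = card {x \<in> carrier G. group.ord G x = n}"

definition exponent :: "('a, 'b) monoid_scheme \<Rightarrow> nat" where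
  "exponent G = Lcm (group.ord G ` carrier G)"

definition num_subgroups_exponent :: "('a, 'b) monoid_scheme \<Rightarrow> nat \<Rightarrow> nat \<Rightarrow> nat" where
  "num_subgroups_exponent G n d =
     card {H. subgroup H G \<and> card H = n \<and> exponent (G\<lparr>carrier := H\<rparr>) = d}"

lemma (in group) card_torsion_eq_sum:
  assumes "finite (carrier G)" "n > 0"
  shows "card (torsion G n) = (\<Sum>d | d dvd n. num_elems_of_ord G d)"
proof -
  have "torsion G n = (\<Union>d\<in>{d. d dvd n}. {x \<in> carrier G. ord x = d})"
    using pow_eq_id unfolding torsion_def by auto
  then show ?thesis
    using assms unfolding num_elems_of_ord_def
    by (simp only:) (subst card_UN_disjoint; auto)
qed

text \<open>Shows that the torsion counts of the \<open>d\<close>-torsion subgroup involve only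
  elements of \<open>G\<close> whose order divides \<open>d\<close>.\<close>

lemma (in comm_group) torsion_torsion_group:
  "torsion (G\<lparr>carrier := torsion G d\<rparr>) n = torsion G (gcd d n)"
  using pow_eq_id unfolding torsion_def by (auto simp flip: nat_pow_consistent)

text \<open>An order that is a multiple of all orders is their least common multiple.\<close>

lemma (in comm_group) exponent_attained:
  assumes "finite (carrier G)"
  obtains x where "x \<in> carrier G" "ord x = exponent G"
proof -
  obtain x where x: "x \<in> carrier G" "\<And>y. y \<in> carrier G \<Longrightarrow> ord y dvd ord x"
    using exists_ord_multiple_of_all_ords[OF assms] by blast
  then have "ord x = exponent G"
    unfolding exponent_def by (intro dvd_antisym dvd_Lcm Lcm_least) auto
  with x(1) that show ?thesis by blast
qed

lemma ord_iso:
  assumes "group G" "group H" "f \<in> iso G H" "x \<in> carrier G"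
  shows "group.ord H (f x) = group.ord G x"
proof -
  interpret G: group G by fact
  interpret H: group H by fact
  have hom: "f \<in> hom G H" and inj: "inj_on f (carrier G)" and fx: "f x \<in> carrier H"
    using assms(3,4) by (auto simp: iso_def bij_betw_def)
  have "f x [^]\<^bsub>H\<^esub> n = \<one>\<^bsub>H\<^esub> \<longleftrightarrow> x [^]\<^bsub>G\<^esub> n = \<one>\<^bsub>G\<^esub>" for n :: nat
    using hom_nat_pow[OF hom assms(4,1,2), of n] hom_one[OF hom assms(1,2)]
      inj_on_eq_iff[OF inj G.nat_pow_closed[OF assms(4)] G.one_closed, of n] by simp
  then show ?thesis
    using assms(4) fx by (simp add: H.ord_unique G.pow_eq_id)
qed

lemma exponent_iso:
  assumes "group G" "group H" "f \<in> iso G H"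
  shows "exponent H = exponent G"
proof -
  have "carrier H = f ` carrier G"
    using assms(3) by (simp add: iso_def bij_betw_def)
  then have "group.ord H ` carrier H = group.ord G ` carrier G"
    using ord_iso[OF assms] by (simp add: image_image)
  then show ?thesis by (simp add: exponent_def)
qed

lemma iso_subgroup_image:
  assumes "group G" "group G'" "f \<in> iso G G'" "subgroup H G"
  shows "subgroup (f ` H) G'" "card (f ` H) = card H"
    "exponent (G'\<lparr>carrier := f ` H\<rparr>) = exponent (G\<lparr>carrier := H\<rparr>)"
proof -
  show sub: "subgroup (f ` H) G'"
    by (rule subgroup.iso_subgroup[OF assms(4,1,2,3)])
  show "card (f ` H) = card H"
    using assms(3) subgroup.subset[OF assms(4)]
    by (intro card_image) (auto simp: iso_def bij_betw_def intro: inj_on_subset)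
  show "exponent (G'\<lparr>carrier := f ` H\<rparr>) = exponent (G\<lparr>carrier := H\<rparr>)"
    by (rule exponent_iso[OF subgroup.subgroup_is_group[OF assms(4,1)]
          subgroup.subgroup_is_group[OF sub assms(2)] iso_restrict[OF assms(3,1,2,4)]])
qed

lemma num_subgroups_exponent_iso:
  assumes "group G" "group G'" "G \<cong> G'"
  shows "num_subgroups_exponent G n d = num_subgroups_exponent G' n d"
proof -
  obtain f where f: "f \<in> iso G G'" using assms(3) by (auto simp: is_iso_def)
  then have bij: "bij_betw f (carrier G) (carrier G')" by (simp add: iso_def)
  define h where "h = inv_into (carrier G) f"
  have h: "h \<in> iso G' G" unfolding h_def by (rule group.iso_set_sym[OF assms(1) f])
  have "bij_betw ((`) f) {H. subgroup H G \<and> card H = n \<and> exponent (G\<lparr>carrier := H\<rparr>) = d}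
      {H. subgroup H G' \<and> card H = n \<and> exponent (G'\<lparr>carrier := H\<rparr>) = d}"
  proof (rule bij_betw_byWitness[where f' = "(`) h"])
    show "\<forall>H\<in>{H. subgroup H G \<and> card H = n \<and> exponent (G\<lparr>carrier := H\<rparr>) = d}. h ` f ` H = H"
      using bij by (auto simp: h_def bij_betw_def inv_into_image_cancel subgroup.subset)
    show "\<forall>H\<in>{H. subgroup H G' \<and> card H = n \<and> exponent (G'\<lparr>carrier := H\<rparr>) = d}. f ` h ` H = H"
      using bij by (auto simp: h_def bij_betw_def image_inv_into_cancel subgroup.subset)
  qed (use iso_subgroup_image[OF assms(1,2) f] iso_subgroup_image[OF assms(2,1) h] in auto)
  then show ?thesis
    unfolding num_subgroups_exponent_def by (rule bij_betw_same_card)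
qed

text \<open>Every element of a subgroup of exponent \<open>d\<close> has order dividing
  \<open>d\<close>, so the subgroup lies inside the \<open>d\<close>-torsion.\<close>

lemma (in comm_group) num_subgroups_exponent_torsion:
  "num_subgroups_exponent (G\<lparr>carrier := torsion G d\<rparr>) n d = num_subgroups_exponent G n d"
proof -
  have "subgroup H (G\<lparr>carrier := torsion G d\<rparr>) \<longleftrightarrow> subgroup H G"
    if "exponent (G\<lparr>carrier := H\<rparr>) = d" for H
  proof
    assume "subgroup H (G\<lparr>carrier := torsion G d\<rparr>)"
    then show "subgroup H G" by (rule incl_subgroup[OF torsion_subgroup])
  next
    assume H: "subgroup H G"
    have "x \<in> torsion G d" if "x \<in> H" for x
    proof -
      have "ord x dvd exponent (G\<lparr>carrier := H\<rparr>)"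
        using that by (auto simp: exponent_def ord_subgroup_consistent[OF H])
      with \<open>exponent _ = d\<close> show ?thesis
        using subgroup.mem_carrier[OF H that] pow_eq_id by (simp add: torsion_def)
    qed
    then show "subgroup H (G\<lparr>carrier := torsion G d\<rparr>)"
      by (intro subgroup_incl[OF H torsion_subgroup]) auto
  qed
  then show ?thesis
    unfolding num_subgroups_exponent_def by (intro arg_cong[where f = card]) auto
qed

text \<open>The exponent of a subgroup of order \<open>n\<close> is the order of one of its
  elements, hence between 1 and \<open>n\<close>.\<close>

lemma (in comm_group) num_subgroups_eq_sum_exponent:
  assumes fin: "finite (carrier G)" and n: "n > 0"
  shows "num_subgroups G n = (\<Sum>d=1..n. num_subgroups_exponent G n d)"
proof -
  have *: "exponent (G\<lparr>carrier := H\<rparr>) \<in> {1..n}" if "subgroup H G" "card H = n" for H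
  proof -
    interpret H: comm_group "G\<lparr>carrier := H\<rparr>"
      by (rule comm_group_subgroup[OF comm_group_axioms that(1)])
    have finH: "finite (carrier (G\<lparr>carrier := H\<rparr>))"
      using that n by (auto intro: card_ge_0_finite)
    obtain x where "x \<in> carrier (G\<lparr>carrier := H\<rparr>)" "H.ord x = exponent (G\<lparr>carrier := H\<rparr>)"
      using H.exponent_attained[OF finH] by blast
    then show ?thesis
      using H.ord_ge_1[OF finH, of x] H.ord_le_group_order[OF finH, of x] that(2)
      by (simp add: order_def)
  qed
  have "{H. subgroup H G \<and> card H = n} =
      (\<Union>d\<in>{1..n}. {H. subgroup H G \<and> card H = n \<and> exponent (G\<lparr>carrier := H\<rparr>) = d})"
    using * by auto
  then have "num_subgroups G n =
      card (\<Union>d\<in>{1..n}. {H. subgroup H G \<and> card H = n \<and> exponent (G\<lparr>carrier := H\<rparr>) = d})"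
    by (simp only: num_subgroups_def)
  also have "\<dots> = (\<Sum>d=1..n. num_subgroups_exponent G n d)"
    unfolding num_subgroups_exponent_def using finite_subgroups[OF fin]
    by (subst card_UN_disjoint) (auto elim: finite_subset[rotated])
  finally show ?thesis .
qed

text \<open>A subgroup of order and exponent \<open>n\<close> is cyclic, so it contains \<open>phi' n\<close> elements of order
  \<open>n\<close>, and it is generated by each of them.\<close>

lemma (in comm_group) num_elems_of_ord_eq:
  assumes fin: "finite (carrier G)" and n: "n > 0"
  shows "num_elems_of_ord G n = num_subgroups_exponent G n n * phi' n"
proof -
  define \<C> where "\<C> = {H. subgroup H G \<and> card H = n \<and> exponent (G\<lparr>carrier := H\<rparr>) = n}"
  have gen: "H = generate G {x}" if H: "subgroup H G" "card H = n" "x \<in> H" "ord x = n" for H x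
  proof -
    have "generate G {x} \<subseteq> H"
      using generate_subgroup_incl[of "{x}" H] H by simp
    moreover have "card (generate G {x}) = card H"
      using generate_pow_card[OF subgroup.mem_carrier[OF H(1,3)]] H by simp
    ultimately show ?thesis
      using card_subset_eq[of H "generate G {x}"] H(2) n card_ge_0_finite[of H] by auto
  qed
  have mem: "generate G {x} \<in> \<C>" if x: "x \<in> carrier G" "ord x = n" for x
  proof -
    have sub: "subgroup (generate G {x}) G" using x by (simp add: generate_is_subgroup)
    have card: "card (generate G {x}) = n" using generate_pow_card x by simp
    interpret H: comm_group "G\<lparr>carrier := generate G {x}\<rparr>"
      by (rule comm_group_subgroup[OF comm_group_axioms sub])
    have "ord y dvd n" if "y \<in> generate G {x}" for y
      using H.ord_dvd_group_order[of y] that card by (simp add: ord_subgroup_consistent[OF sub] order_def)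
    then have "exponent (G\<lparr>carrier := generate G {x}\<rparr>) = n"
      unfolding exponent_def using x
      by (intro dvd_antisym Lcm_least dvd_Lcm)
        (auto simp: ord_subgroup_consistent[OF sub] generate.incl image_iff intro!: bexI[of _ x])
    with sub card show ?thesis by (simp add: \<C>_def)
  qed
  have class_card: "card {x \<in> H. ord x = n} = phi' n" if "H \<in> \<C>" for H
  proof -
    have H: "subgroup H G" "card H = n" using that by (auto simp: \<C>_def)
    interpret H: comm_group "G\<lparr>carrier := H\<rparr>"
      by (rule comm_group_subgroup[OF comm_group_axioms H(1)])
    have "finite H" using H(2) n by (auto intro: card_ge_0_finite)
    then obtain a where "a \<in> carrier (G\<lparr>carrier := H\<rparr>)" "H.ord a = exponent (G\<lparr>carrier := H\<rparr>)"
      using H.exponent_attained by auto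
    then have "a \<in> H" "ord a = n"
      using that by (simp_all add: \<C>_def ord_subgroup_consistent[OF H(1)])
    then have a: "a \<in> carrier G" "ord a = n" "H = generate G {a}"
      using gen[OF H] subgroup.mem_carrier[OF H(1)] by simp_all
    have inj: "inj_on (\<lambda>k. a [^] k) {1..n}"
      using ord_inj'[OF a(1)] a(2) by simp
    \<comment> \<open>The exponents run from 1 to \<open>n\<close> instead of 0 to
      \<open>n - 1\<close> to match the range in \<open>phi'_def\<close>.\<close>
    have H_eq: "H = (\<lambda>k. a [^] k) ` {1..n}"
    proof (rule card_subset_eq[symmetric, OF \<open>finite H\<close>])
      show "(\<lambda>k. a [^] k) ` {1..n} \<subseteq> H"
        using generate_pow_on_finite_carrier[OF fin a(1)] a(3) by auto
      show "card ((\<lambda>k. a [^] k) ` {1..n}) = card H"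
        using card_image[OF inj] H(2) by simp
    qed
    have "{x \<in> H. ord x = n} = (\<lambda>k. a [^] k) ` {k. 1 \<le> k \<and> k \<le> n \<and> coprime k n}"
      unfolding H_eq using pow_ord_eq_ord_iff[OF fin a(1)] a(2) by auto
    moreover have "inj_on (\<lambda>k. a [^] k) {k. 1 \<le> k \<and> k \<le> n \<and> coprime k n}"
      by (rule inj_on_subset[OF inj]) auto
    ultimately show ?thesis by (simp add: card_image phi'_def)
  qed
  have "{x \<in> carrier G. ord x = n} = (\<Union>H\<in>\<C>. {x \<in> H. ord x = n})"
  proof (intro equalityI subsetI)
    fix x assume "x \<in> {x \<in> carrier G. ord x = n}"
    then show "x \<in> (\<Union>H\<in>\<C>. {x \<in> H. ord x = n})"
      using mem[of x] generate.incl[of x "{x}" G] by auto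
  qed (auto simp: \<C>_def dest: subgroup.mem_carrier)
  moreover have "card (\<Union>H\<in>\<C>. {x \<in> H. ord x = n}) = (\<Sum>H\<in>\<C>. card {x \<in> H. ord x = n})"
  proof (rule card_UN_disjoint)
    show "finite \<C>"
      unfolding \<C>_def using finite_subgroups[OF fin] by (auto elim: finite_subset[rotated])
    show "\<forall>H\<in>\<C>. finite {x \<in> H. ord x = n}"
      using fin by (auto simp: \<C>_def dest!: subgroup.subset intro: finite_subset)
    \<comment> \<open>A common element of order \<open>n\<close> would generate both
      subgroups.\<close>
    show "\<forall>H\<in>\<C>. \<forall>K\<in>\<C>. H \<noteq> K \<longrightarrow> {x \<in> H. ord x = n} \<inter> {x \<in> K. ord x = n} = {}"
      unfolding \<C>_def using gen by blast
  qed
  ultimately show ?thesis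
    by (simp add: num_elems_of_ord_def class_card num_subgroups_exponent_def \<C>_def)
qed

section \<open>Recovering the element orders, and the conclusion\<close>

lemma num_elems_of_ord_eqI:
  assumes "comm_group G" and fin: "finite (carrier G)"
    and "comm_group G'" and fin': "finite (carrier G')"
    and eq: "\<And>m. num_subgroups G m = num_subgroups G' m"
  shows "n > 0 \<Longrightarrow> num_elems_of_ord G n = num_elems_of_ord G' n"
proof (induction n rule: less_induct)
  case (less n)
  interpret G: comm_group G by fact
  interpret G': comm_group G' by fact
  have "num_subgroups_exponent G n d = num_subgroups_exponent G' n d" if d: "d \<in> {1..<n}" for d
  proof -
    let ?T = "G\<lparr>carrier := torsion G d\<rparr>" and ?T' = "G'\<lparr>carrier := torsion G' d\<rparr>"
    have grps: "comm_group ?T" "comm_group ?T'"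
      by (simp_all add: comm_group_subgroup assms G.torsion_subgroup G'.torsion_subgroup)
    have "?T \<cong> ?T'"
    proof (rule iso_if_card_torsion_eq[OF grps(1) _ grps(2)])
      show "finite (carrier ?T)" "finite (carrier ?T')"
        using fin fin' by (auto simp: torsion_def)
      fix k :: nat assume "k > 0"
      have pos: "gcd d k > 0" and le: "gcd d k < n"
        using d \<open>k > 0\<close> by (auto intro: le_less_trans[OF gcd_le1_nat])
      \<comment> \<open>A divisor of \<open>gcd d k\<close> is positive and at most
        \<open>d < n\<close>, so the induction hypothesis covers every order occurring in the
        torsion counts of \<open>?T\<close> and \<open>?T'\<close>.\<close>
      have "num_elems_of_ord G e = num_elems_of_ord G' e" if "e dvd gcd d k" for e
        using dvd_imp_le[OF that pos] dvd_pos_nat[OF pos that] le by (intro less.IH) simp_all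
      then show "card (torsion ?T k) = card (torsion ?T' k)"
        using pos by (simp add: G.torsion_torsion_group G'.torsion_torsion_group
            G.card_torsion_eq_sum[OF fin] G'.card_torsion_eq_sum[OF fin'])
    qed
    then show ?thesis
      using num_subgroups_exponent_iso[of ?T ?T' n d] grps
      by (simp add: comm_group_def G.num_subgroups_exponent_torsion G'.num_subgroups_exponent_torsion)
  qed
  \<comment> \<open>With the terms for \<open>d < n\<close> equal, the equality of the totals leaves
    that of the term \<open>d = n\<close>, which counts the cyclic subgroups of order
    \<open>n\<close>.\<close>
  moreover have "{1..n} = insert n {1..<n}" using less.prems by auto
  ultimately have "num_subgroups_exponent G n n = num_subgroups_exponent G' n n"
    using eq[of n] G.num_subgroups_eq_sum_exponent[OF fin less.prems]
      G'.num_subgroups_eq_sum_exponent[OF fin' less.prems] by simp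
  then show ?case
    using G.num_elems_of_ord_eq[OF fin less.prems] G'.num_elems_of_ord_eq[OF fin' less.prems] by simp
qed

theorem theorem2p6:
  fixes G :: "('a, 'm) monoid_scheme" and G' :: "('b, 'n) monoid_scheme"
  assumes "comm_group G" and "finite (carrier G)"
    and "comm_group G'" and "finite (carrier G')"
    and "\<And>s :: complex. group_zeta G s = group_zeta G' s"
  shows "G \<cong> G'"
proof (rule iso_if_card_torsion_eq[OF assms(1-4)])
  fix n :: nat assume n: "n > 0"
  have "num_elems_of_ord G d = num_elems_of_ord G' d" if "d dvd n" for d
    using num_elems_of_ord_eqI[OF assms(1-4) group_zeta_determines_num_subgroups[OF assms(2,4,5)]]
      dvd_pos_nat[OF n that] .
  then show "card (torsion G n) = card (torsion G' n)"
    using n group.card_torsion_eq_sum[of G n] group.card_torsion_eq_sum[of G' n] assms(1-4)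
    by (simp add: comm_group_def)
qed

end
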